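(* For each $n\ge 1$ let $$p_n(x)=\prod_{j=1}^n (x-x_{j,n})=\sum_{k=0}^n(-1)^k a_{k,n}x^{n-k}$$ be a monic polynomial of degree $n$ all of whose zeros $x_{1,n},\dots,x_{n,n}$ are real and strictly positive. Suppose that the zero counting measures $\mu_n=\frac1n\sum_{k=1}^n\delta_{x_{k,n}}$ converge weakly to a probability measure $\mu$ on $[0,\infty)$ with $\mu(\{0\})=0$, and that all moments of $\mu$ are finite and the moment generating series $M(z)=\sum_{m\ge1} z^m\int_0^\infty x^m\,d\mu(x)$ has positive radius of convergence. For $t\in(0,1)$ let $$f(t)=\lim_{n\to\infty,\ k/n\to t}\frac{a_{k,n}}{a_{k-1,n}}.$$ Then the $S$-transform $S$ of $\mu$ is given by $$S(u)=-\frac{u+1}{u}\,\frac{1}{f(-u)}$$ for all real $u<0$ sufficiently close to $0$.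
   Context: The limit defining $f$ is taken along arbitrary sequences of integers $k=k_n$ with $1\le k_n\le n$ and $k_n/n\to t$. Under the stated hypotheses on $p_n$ and $\mu_n$, the existence of this limit (independent of the chosen sequence $k_n$), with values in $(0,\infty)$, for every $t\in(0,1)$ is a known theorem (Van Assche, Fano, Ortolani, 1987). $S$-transform: for a probability measure $\mu$ on $[0,\infty)$ with finite moments $m_m=\int_0^\infty x^m\,d\mu(x)$, put $$M(z)=\int_0^\infty\frac{zx}{1-zx}\,d\mu(x)=\sum_{m=1}^\infty m_m z^m,$$ where the series is assumed to have positive radius of convergence. Then $M(0)=0$, and if $\mu\neq\delta_0$ then $M'(0)=m_1>0$, so $M$ has a local analytic inverse $M^{-1}$ in a neighborhood of $0$ with $M^{-1}(0)=0$. The $S$-transform of $\mu$ is $$S(u)=\frac{u+1}{u}\,M^{-1}(u)$$ for $u$ in a neighborhood of $0$ (with the removable singularity at $u=0$ filled in). *)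

theory Defs
  imports "HOL-Probability.Probability" "HOL-Complex_Analysis.Complex_Analysis"
begin

definition zero_counting_measure :: "nat \<Rightarrow> (nat \<Rightarrow> real) \<Rightarrow> real measure" where
  "zero_counting_measure n x = distr (uniform_count_measure {1..n}) borel x"

lemma measure_zero_counting_measure:
  assumes "A \<in> sets borel"
  shows "measure (zero_counting_measure n x) A = (1 / real n) * (\<Sum>k=1..n. indicator A (x k))"
proof -
  have m: "x \<in> measurable (uniform_count_measure {1..n}) borel"
    by (simp add: measurable_def sets_uniform_count_measure space_uniform_count_measure)
  have "measure (zero_counting_measure n x) A
      = measure (uniform_count_measure {1..n}) (x -` A \<inter> {1..n})"
    unfolding zero_counting_measure_def using measure_distr[OF m assms]
    by (simp add: space_uniform_count_measure)
  also have "\<dots> = real (card (x -` A \<inter> {1..n})) / real n"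
    by (subst measure_uniform_count_measure) auto
  also have "real (card (x -` A \<inter> {1..n})) = (\<Sum>k=1..n. indicator A (x k))"
    by (subst sum.cong[OF refl, of _ _ "\<lambda>k. indicator (x -` A) k"])
       (auto simp: indicator_def sum.If_cases Int_commute vimage_def Collect_conj_eq)
  finally show ?thesis by simp
qed

text \<open>
  The limit of \<open>a\<^sub>k\<^sub>,\<^sub>n / a\<^sub>k\<^sub>-\<^sub>1\<^sub>,\<^sub>n\<close> as \<open>n \<rightarrow> \<infinity>\<close> and \<open>k/n \<rightarrow> t\<close>, where \<open>a n k\<close> stands for \<open>a\<^sub>k\<^sub>,\<^sub>n\<close>.
\<close>

definition has_ratio_limit :: "(nat \<Rightarrow> nat \<Rightarrow> real) \<Rightarrow> real \<Rightarrow> real \<Rightarrow> bool" where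
  "has_ratio_limit a t L \<longleftrightarrow>
     (\<forall>k::nat \<Rightarrow> nat. (\<forall>n\<ge>1. 1 \<le> k n \<and> k n \<le> n) \<longrightarrow> (\<lambda>n. real (k n) / real n) \<longlonglongrightarrow> t
        \<longrightarrow> (\<lambda>n. a n (k n) / a n (k n - 1)) \<longlonglongrightarrow> L)"

definition ratio_limit :: "(nat \<Rightarrow> nat \<Rightarrow> real) \<Rightarrow> real \<Rightarrow> real" where
  "ratio_limit a t = (THE L. has_ratio_limit a t L)"

lemma has_ratio_limit_unique:
  assumes t: "0 < t" "t < 1" and L: "has_ratio_limit a t L" "has_ratio_limit a t L'"
  shows "L = L'"
proof -
  define k where "k n = nat \<lceil>t * real n\<rceil>" for n :: nat
  have k: "1 \<le> k n \<and> k n \<le> n" if "n \<ge> 1" for n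
  proof -
    have "t * real n > 0" "t * real n \<le> real n"
      using t that by (auto simp: mult_le_cancel_right1)
    then show ?thesis by (auto simp: k_def le_nat_iff nat_le_iff ceiling_le_iff)
  qed
  have lim: "(\<lambda>n. real (k n) / real n) \<longlonglongrightarrow> t"
  proof (rule tendsto_sandwich)
    have b: "t * real n \<le> real (k n) \<and> real (k n) \<le> t * real n + 1" for n
    proof -
      have "t * real n \<ge> 0" using t by simp
      then have "real (k n) = of_int \<lceil>t * real n\<rceil>" by (simp add: k_def)
      then show ?thesis by linarith
    qed
    show "\<forall>\<^sub>F n in sequentially. t \<le> real (k n) / real n"
      using eventually_gt_at_top[of 0] by eventually_elim (use b in \<open>auto simp: field_simps\<close>)
    show "\<forall>\<^sub>F n in sequentially. real (k n) / real n \<le> t + 1 / real n"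
      using eventually_gt_at_top[of 0] by eventually_elim (use b in \<open>auto simp: field_simps\<close>)
    show "(\<lambda>n. t + 1 / real n) \<longlonglongrightarrow> t"
      using tendsto_add[OF tendsto_const lim_1_over_n, of t] by simp
  qed simp
  show ?thesis
    using L k lim unfolding has_ratio_limit_def by (blast intro: LIMSEQ_unique)
qed

lemma ratio_limit_eqI:
  "0 < t \<Longrightarrow> t < 1 \<Longrightarrow> has_ratio_limit a t L \<Longrightarrow> ratio_limit a t = L"
  unfolding ratio_limit_def by (blast intro: has_ratio_limit_unique)

definition moment_series :: "real measure \<Rightarrow> complex fps" where
  "moment_series \<mu> = Abs_fps (\<lambda>m. if m = 0 then 0 else of_real (LINT x|\<mu>. x ^ m))"

definition moment_function :: "real measure \<Rightarrow> complex \<Rightarrow> complex" where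
  "moment_function \<mu> = eval_fps (moment_series \<mu>)"

definition local_inverse_at_0 :: "(complex \<Rightarrow> complex) \<Rightarrow> (complex \<Rightarrow> complex) \<Rightarrow> bool" where
  "local_inverse_at_0 F G \<longleftrightarrow> G analytic_on {0} \<and> G 0 = 0
     \<and> (\<forall>\<^sub>F u in nhds 0. F (G u) = u) \<and> (\<forall>\<^sub>F z in nhds 0. G (F z) = z)"

text \<open>
  A local inverse is determined only as a germ at \<open>0\<close>. The choice made in \<open>moment_inverse\<close>
  below is therefore irrelevant for assertions that hold sufficiently close to \<open>0\<close>.
\<close>

lemma local_inverse_at_0_unique:
  assumes "local_inverse_at_0 F G" "local_inverse_at_0 F H"
  shows "\<forall>\<^sub>F u in nhds 0. G u = H u"
proof -
  have "isCont G 0"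
    using assms(1) analytic_at_imp_isCont by (auto simp: local_inverse_at_0_def)
  then have "filterlim G (nhds 0) (nhds 0)"
    using assms(1) by (simp add: local_inverse_at_0_def continuous_at tendsto_at_iff_tendsto_nhds)
  then have "\<forall>\<^sub>F u in nhds 0. H (F (G u)) = G u"
    using assms(2) by (auto simp: local_inverse_at_0_def filterlim_iff)
  moreover have "\<forall>\<^sub>F u in nhds 0. F (G u) = u"
    using assms(1) by (simp add: local_inverse_at_0_def)
  ultimately show ?thesis by eventually_elim simp
qed

lemma local_inverse_at_0_exists:
  assumes "F analytic_on {0}" "F 0 = 0" "deriv F 0 \<noteq> 0"
  shows "\<exists>G. local_inverse_at_0 F G"
proof -
  obtain e where e: "e > 0" "F holomorphic_on ball 0 e"
    using assms(1) by (auto simp: analytic_on_def)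
  obtain r where r: "r > 0" "ball 0 r \<subseteq> ball (0::complex) e" "open (F ` ball 0 r)" "inj_on F (ball 0 r)"
    using has_complex_derivative_locally_invertible[OF e(2) centre_in_ball[THEN iffD2, OF e(1)]
      open_ball assms(3)] .
  have hol: "F holomorphic_on ball 0 r"
    using e(2) r(2) by (rule holomorphic_on_subset)
  obtain G where G: "G holomorphic_on (F ` ball 0 r)" "\<And>z. z \<in> ball 0 r \<Longrightarrow> G (F z) = z"
    using holomorphic_has_inverse[OF hol open_ball r(4)] by metis
  have 0: "0 \<in> F ` ball 0 r" using assms(2) r(1) by (force intro: image_eqI[of _ _ 0])
  have "G analytic_on {0}"
    using G(1) r(3) 0 analytic_at by blast
  moreover have "G 0 = 0" using G(2)[of 0] assms(2) r(1) by simp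
  moreover have "\<forall>\<^sub>F u in nhds 0. F (G u) = u"
    using eventually_nhds_in_open[OF r(3) 0] by eventually_elim (auto simp: G(2))
  moreover have "\<forall>\<^sub>F z in nhds 0. G (F z) = z"
    using eventually_nhds_in_open[of "ball 0 r" 0] r(1)
    by (auto elim!: eventually_mono simp: G(2))
  ultimately show ?thesis unfolding local_inverse_at_0_def by blast
qed

definition moment_inverse :: "real measure \<Rightarrow> complex \<Rightarrow> complex" where
  "moment_inverse \<mu> = (SOME G. local_inverse_at_0 (moment_function \<mu>) G)"

definition S_transform :: "real measure \<Rightarrow> complex \<Rightarrow> complex" where
  "S_transform \<mu> u =
     (if u = 0 then Lim (at 0) (\<lambda>v. (v + 1) / v * moment_inverse \<mu> v)
      else (u + 1) / u * moment_inverse \<mu> u)"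

end

theory Submission
  imports Defs
begin

text \<open>
  Let \<open>P\<^sub>n(z) = \<Prod>\<^sub>j (1 + x\<^sub>j z) = \<Sum>\<^sub>k a\<^sub>k z\<^sup>k\<close>.  For \<open>z > 0\<close> the weights \<open>a\<^sub>k z\<^sup>k\<close> have mean
  \<open>z P\<^sub>n'(z) / P\<^sub>n(z) = \<Sum>\<^sub>j x\<^sub>j z / (1 + x\<^sub>j z)\<close>, which divided by \<open>n\<close> tends to
  \<open>\<phi>(z) = \<integral> yz / (1 + yz) d\<mu> = -M(-z)\<close> by weak convergence.  The coefficients are log-concave, so if
  \<open>a\<^sub>k / a\<^sub>k\<^sub>-\<^sub>1 \<le> 1/w\<close> and \<open>z < w\<close>, then the weights decay geometrically beyond \<open>k\<close> and the mean at \<open>z\<close>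
  is at most \<open>k + O(1)\<close>; similarly in the other direction.  As \<open>\<phi>\<close> is strictly increasing, this forces
  \<open>a\<^sub>k / a\<^sub>k\<^sub>-\<^sub>1 \<rightarrow> 1/z\<close> whenever \<open>k/n \<rightarrow> \<phi>(z)\<close>.  Hence \<open>f(\<phi>(z)) = 1/z\<close>, and for \<open>u = -\<phi>(z)\<close> close to \<open>0\<close>
  the inverse of \<open>M\<close> takes the value \<open>-z = -1/f(-u)\<close> at \<open>u\<close>.
\<close>

section \<open>Coefficients of products of linear factors\<close>

lemma degree_prod_linear_le:
  fixes x :: "'a \<Rightarrow> real"
  assumes "finite A"
  shows "degree (\<Prod>j\<in>A. [:1, x j:]) \<le> card A"
proof -
  have "degree (\<Prod>j\<in>A. [:1, x j:]) \<le> (\<Sum>j\<in>A. degree [:1, x j:])"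
    using degree_prod_sum_le[OF assms, of "\<lambda>j. [:1, x j:]"] by (simp add: o_def)
  also have "\<dots> \<le> card A" using sum_bounded_above[of A "\<lambda>j. degree [:1, x j:]" 1] by simp
  finally show ?thesis .
qed

lemma prod_linear_pos_coeff_pos:
  fixes x :: "'a \<Rightarrow> real"
  assumes "finite A" "\<And>j. j \<in> A \<Longrightarrow> 0 < x j" "k \<le> card A"
  shows "0 < coeff (\<Prod>j\<in>A. [:1, x j:]) k"
  using assms
proof (induction A arbitrary: k rule: finite_induct)
  case (insert b A)
  show ?case
  proof (cases k)
    case 0
    then show ?thesis using insert by simp
  next
    case (Suc i)
    have 1: "0 < coeff (\<Prod>j\<in>A. [:1, x j:]) i" "0 < x b" using insert Suc by auto
    have "0 \<le> coeff (\<Prod>j\<in>A. [:1, x j:]) (Suc i)"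
    proof (cases "Suc i \<le> card A")
      case True then show ?thesis using insert by (intro less_imp_le) auto
    next
      case False
      then show ?thesis using degree_prod_linear_le[OF insert.hyps(1), of x]
        by (simp add: coeff_eq_0)
    qed
    with 1 show ?thesis using insert.hyps Suc by (simp add: add_nonneg_pos)
  qed
qed simp

lemma prod_linear_coeff_nonneg:
  fixes x :: "'a \<Rightarrow> real"
  assumes "\<And>j. j \<in> A \<Longrightarrow> 0 \<le> x j"
  shows "0 \<le> coeff (\<Prod>j\<in>A. [:1, x j:]) k"
  using assms
proof (induction A arbitrary: k rule: infinite_finite_induct)
  case (insert b A)
  then show ?case by (cases k) auto
qed auto

text \<open>Adjoining the factor \<open>1 + x b * z\<close> turns \<open>c (Suc k)\<close> into
  \<open>c (Suc k) + x b * c k\<close>, and the inequality is compared power by power in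
  \<open>x b\<close>. The division-free form for all \<open>i \<le> k\<close> keeps the induction
  closed and tolerates vanishing coefficients.\<close>

lemma prod_linear_coeff_log_concave:
  fixes x :: "'a \<Rightarrow> real"
  assumes "\<And>j. j \<in> A \<Longrightarrow> 0 \<le> x j" "i \<le> k"
  shows "coeff (\<Prod>j\<in>A. [:1, x j:]) (Suc k) * coeff (\<Prod>j\<in>A. [:1, x j:]) i
       \<le> coeff (\<Prod>j\<in>A. [:1, x j:]) k * coeff (\<Prod>j\<in>A. [:1, x j:]) (Suc i)"
  using assms
proof (induction A arbitrary: i k rule: infinite_finite_induct)
  case (insert b A)
  define c where "c = coeff (\<Prod>j\<in>A. [:1, x j:])"
  have x: "0 \<le> x b" using insert by auto
  have c0: "0 \<le> c m" for m
    unfolding c_def using insert.prems by (intro prod_linear_coeff_nonneg) auto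
  have IH: "c (Suc k) * c i \<le> c k * c (Suc i)" if "i \<le> k" for i k
    unfolding c_def using insert.prems that by (intro insert.IH) auto
  show ?case
  proof (cases i)
    case 0
    show ?thesis
    proof (cases k)
      case k: (Suc l)
      have "c (Suc k) * c 0 \<le> c k * c 1" using IH[of 0 k] by simp
      moreover have "0 \<le> x b * (c l * c 1)" "0 \<le> x b * x b * (c l * c 0)" using x c0 by auto
      ultimately show ?thesis using insert.hyps 0 k
        by (simp add: c_def[symmetric]) (simp add: algebra_simps)
    qed (use 0 insert in \<open>simp add: algebra_simps\<close>)
  next
    case i: (Suc m)
    then obtain l where k: "k = Suc l" "m \<le> l" using insert.prems by (cases k) auto
    have 1: "c (Suc k) * c i \<le> c k * c (Suc i)" using IH[of i k] insert.prems by simp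
    have 2: "x b * x b * (c k * c m) \<le> x b * x b * (c l * c i)"
      using IH[of m l] i k x by (intro mult_left_mono) auto
    \<comment> \<open>This is the part linear in \<open>x b\<close>, after cancelling
      \<open>c k * c i\<close>. For \<open>i < k\<close> two instances of the induction hypothesis
      are chained; for \<open>i = k\<close> both sides coincide.\<close>
    have "c (Suc k) * c m \<le> c l * c (Suc i)"
    proof (cases "i = k")
      case True then show ?thesis using i k by simp
    next
      case False
      have "c (Suc k) * c m \<le> c k * c i" using IH[of m k] i k by simp
      also have "\<dots> \<le> c l * c (Suc i)" using IH[of i l] i k False by simp
      finally show ?thesis .
    qed
    then have 3: "x b * (c (Suc k) * c m) \<le> x b * (c l * c (Suc i))"
      using x by (rule mult_left_mono)
    show ?thesis using 1 2 3 i k insert.hyps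
      by (simp add: c_def[symmetric]) (simp add: algebra_simps)
  qed
qed auto

lemma sum_coeff_prod_linear:
  fixes x :: "'a \<Rightarrow> real"
  assumes "finite A"
  shows "(\<Sum>k\<le>card A. coeff (\<Prod>j\<in>A. [:1, x j:]) k * z ^ k) = (\<Prod>j\<in>A. 1 + x j * z)"
proof -
  have "poly (\<Prod>j\<in>A. [:1, x j:]) z = (\<Sum>k\<le>card A. coeff (\<Prod>j\<in>A. [:1, x j:]) k * z ^ k)"
    unfolding poly_altdef using degree_prod_linear_le[OF assms, of x]
    by (intro sum.mono_neutral_left) (auto simp: coeff_eq_0)
  then show ?thesis by (simp add: poly_prod mult.commute)
qed

text \<open>Both sides are \<open>z\<close> times the derivative of the product, computed termwise
  on the left and by logarithmic differentiation on the right.\<close>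

lemma sum_index_coeff_prod_linear:
  fixes x :: "'a \<Rightarrow> real"
  assumes "finite A" "\<And>j. j \<in> A \<Longrightarrow> 0 \<le> x j" "0 \<le> z"
  shows "(\<Sum>k\<le>card A. real k * (coeff (\<Prod>j\<in>A. [:1, x j:]) k * z ^ k))
       = (\<Prod>j\<in>A. 1 + x j * z) * (\<Sum>j\<in>A. x j * z / (1 + x j * z))"
proof -
  let ?c = "coeff (\<Prod>j\<in>A. [:1, x j:])"
  have 1: "((\<lambda>z. \<Sum>k\<le>card A. ?c k * z ^ k) has_field_derivative
      (\<Sum>k\<le>card A. ?c k * (real k * z ^ (k - 1)))) (at z)"
    by (auto intro!: derivative_eq_intros simp: mult_ac)
  have nz: "1 + x j * z \<noteq> 0" if "j \<in> A" for j
    using assms(2)[OF that] assms(3) by (smt (verit) mult_nonneg_nonneg)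
  have "((\<lambda>z. \<Prod>j\<in>A. 1 + x j * z) has_field_derivative
      (\<Prod>j\<in>A. 1 + x j * z) * (\<Sum>j\<in>A. x j / (1 + x j * z))) (at z)"
    using nz by (intro has_field_derivative_prod') (auto intro!: derivative_eq_intros)
  then have "(\<Sum>k\<le>card A. ?c k * (real k * z ^ (k - 1)))
     = (\<Prod>j\<in>A. 1 + x j * z) * (\<Sum>j\<in>A. x j / (1 + x j * z))"
    using 1 unfolding sum_coeff_prod_linear[OF assms(1)] by (rule DERIV_unique[rotated])
  then have "z * (\<Sum>k\<le>card A. ?c k * (real k * z ^ (k - 1)))
     = (\<Prod>j\<in>A. 1 + x j * z) * (z * (\<Sum>j\<in>A. x j / (1 + x j * z)))" by simp
  moreover have "z * (\<Sum>j\<in>A. x j / (1 + x j * z)) = (\<Sum>j\<in>A. x j * z / (1 + x j * z))"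
    by (simp add: sum_distrib_left mult.commute)
  \<comment> \<open>At \<open>k = 0\<close> the truncated exponent \<open>k - 1\<close> is harmless
    because the factor \<open>real k\<close> vanishes.\<close>
  moreover have "z * (?c k * (real k * z ^ (k - 1))) = real k * (?c k * z ^ k)" for k
    by (cases k) (auto simp: mult_ac)
  then have "z * (\<Sum>k\<le>card A. ?c k * (real k * z ^ (k - 1)))
    = (\<Sum>k\<le>card A. real k * (?c k * z ^ k))"
    unfolding sum_distrib_left by (intro sum.cong) auto
  ultimately show ?thesis by simp
qed

text \<open>With \<open>n = card A\<close>, the product of the \<open>1 + x j * z\<close> is
  \<open>(- z) ^ n\<close> times the monic polynomial at \<open>- 1 / z\<close>; this reverses the
  coefficients and removes the alternating signs.\<close>

lemma coeff_prod_linear_reverse: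
  fixes x :: "'a \<Rightarrow> real"
  assumes "finite A"
    and eq: "(\<Prod>j\<in>A. [:- x j, 1:]) = (\<Sum>k\<le>card A. monom ((-1) ^ k * c k) (card A - k))"
    and "k \<le> card A"
  shows "coeff (\<Prod>j\<in>A. [:1, x j:]) k = c k"
proof -
  \<comment> \<open>The substitution \<open>- 1 / z\<close> excludes \<open>z = 0\<close>. The extra
    factor \<open>[:0, 1:]\<close> makes that point trivial and is cancelled afterwards.\<close>
  have "poly ([:0, 1:] * (\<Prod>j\<in>A. [:1, x j:])) z
      = poly ([:0, 1:] * (\<Sum>k\<le>card A. monom (c k) k)) z" for z
  proof (cases "z = 0")
    case False
    have p: "poly [:- x j, 1:] (- 1 / z) = - 1 / z - x j" for j by simp
    have "(\<Prod>j\<in>A. 1 + x j * z) = (\<Prod>j\<in>A. (- z) * (- 1 / z - x j))"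
      using False by (intro prod.cong) (auto simp: field_simps)
    also have "\<dots> = (- z) ^ card A * poly (\<Prod>j\<in>A. [:- x j, 1:]) (- 1 / z)"
      unfolding prod.distrib prod_constant poly_prod p ..
    also have "\<dots> = (\<Sum>k\<le>card A. (- z) ^ card A * ((-1) ^ k * c k * (- 1 / z) ^ (card A - k)))"
      unfolding eq by (simp add: poly_sum poly_monom sum_distrib_left)
    also have "\<dots> = (\<Sum>k\<le>card A. c k * z ^ k)"
    proof (intro sum.cong refl)
      fix k assume "k \<in> {..card A}"
      then have *: "(- z) ^ card A = (- z) ^ k * (- z) ^ (card A - k)"
        by (simp flip: power_add)
      have "(- z) ^ (card A - k) * (- 1 / z) ^ (card A - k) = 1"
        using False by (simp flip: power_mult_distrib)
      moreover have "(- z) ^ k * (- 1) ^ k = z ^ k" by (simp flip: power_mult_distrib)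
      ultimately show "(- z) ^ card A * ((-1) ^ k * c k * (- 1 / z) ^ (card A - k)) = c k * z ^ k"
        unfolding * by (metis (no_types, lifting) mult.assoc mult.commute mult_1)
    qed
    finally show ?thesis by (simp add: poly_prod poly_sum poly_monom mult.commute)
  qed simp
  then have "[:0, 1:] * (\<Prod>j\<in>A. [:1, x j:]) = [:0, 1:] * (\<Sum>k\<le>card A. monom (c k) k)"
    using poly_eq_poly_eq_iff by blast
  then have "(\<Prod>j\<in>A. [:1, x j:]) = (\<Sum>k\<le>card A. monom (c k) k)"
    unfolding mult_cancel_left by simp
  then show ?thesis using assms(3) by (simp add: coeff_sum)
qed

section \<open>Mean index of weights with geometric decay or growth\<close>

text \<open>Only indices above \<open>l\<close> can push the mean beyond \<open>l\<close>, and the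
  index \<open>l + i\<close> has weight at most \<open>q ^ i * c l\<close>. The resulting constant
  depends on \<open>q\<close> alone, so it disappears in the limit after division by
  \<open>n\<close>.\<close>

lemma sum_index_le_of_geometric_decay:
  fixes c :: "nat \<Rightarrow> real"
  assumes "0 < q" "q < 1" "l \<le> n" "\<And>j. j \<le> n \<Longrightarrow> 0 \<le> c j"
    and decay: "\<And>j. l \<le> j \<Longrightarrow> j < n \<Longrightarrow> c (Suc j) \<le> q * c j"
  shows "(\<Sum>j\<le>n. real j * c j) \<le> (real l + 1 / (1 - q)\<^sup>2) * (\<Sum>j\<le>n. c j)"
proof -
  have geo: "c (l + i) \<le> q ^ i * c l" if "l + i \<le> n" for i
    using that
  proof (induction i)
    case (Suc i)
    have "c (l + Suc i) \<le> q * c (l + i)" using decay[of "l + i"] Suc.prems by simp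
    also have "\<dots> \<le> q * (q ^ i * c l)" using Suc assms(1) by (intro mult_left_mono) auto
    finally show ?case by (simp add: mult.assoc)
  qed simp
  \<comment> \<open>The excess is \<open>i\<close>; bounding it by \<open>Suc i\<close> gives the
    differentiated geometric series with its closed form.\<close>
  have sums: "(\<lambda>i. real (Suc i) * q ^ i) sums (1 / (1 - q)\<^sup>2)"
    using geometric_deriv_sums[of q] assms(1,2) by simp
  have "(\<Sum>j\<le>n. (real j - real l) * c j) \<le> (\<Sum>j\<in>{l..n}. (real j - real l) * c j)"
  proof -
    have "(\<Sum>j\<le>n. (real j - real l) * c j)
      = (\<Sum>j\<in>{..<l}. (real j - real l) * c j) + (\<Sum>j\<in>{l..n}. (real j - real l) * c j)"
      using assms(3) by (subst sum.union_disjoint[symmetric]) (auto intro!: sum.cong)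
    moreover have "(\<Sum>j\<in>{..<l}. (real j - real l) * c j) \<le> 0"
      using assms(3,4) by (intro sum_nonpos mult_nonpos_nonneg) auto
    ultimately show ?thesis by simp
  qed
  also have "\<dots> = (\<Sum>i\<le>n - l. real i * c (l + i))"
    using assms(3) by (intro sum.reindex_bij_witness[of _ "\<lambda>i. l + i" "\<lambda>j. j - l"]) auto
  also have "\<dots> \<le> (\<Sum>i\<le>n - l. real (Suc i) * q ^ i * c l)"
  proof (intro sum_mono)
    fix i assume "i \<in> {..n - l}"
    then have i: "l + i \<le> n" using assms(3) by auto
    show "real i * c (l + i) \<le> real (Suc i) * q ^ i * c l"
      using geo[OF i] assms(4)[OF i] unfolding mult.assoc by (intro mult_mono) auto
  qed
  also have "\<dots> = (\<Sum>i\<le>n - l. real (Suc i) * q ^ i) * c l" by (simp add: sum_distrib_right)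
  also have "\<dots> \<le> 1 / (1 - q)\<^sup>2 * (\<Sum>j\<le>n. c j)"
  proof (intro mult_mono)
    show "(\<Sum>i\<le>n - l. real (Suc i) * q ^ i) \<le> 1 / (1 - q)\<^sup>2"
      using sums assms(1) sum_le_suminf[of "\<lambda>i. real (Suc i) * q ^ i" "{..n - l}"]
      by (auto simp: sums_iff)
    show "c l \<le> (\<Sum>j\<le>n. c j)" using assms(3,4) by (intro member_le_sum) auto
  qed (use assms in auto)
  finally show ?thesis
    by (simp add: algebra_simps sum_subtractf sum_distrib_left)
qed

text \<open>Reflecting the indices by \<open>n - j\<close> turns growth up to \<open>l\<close> into
  decay from \<open>n - l\<close> on.\<close>

lemma sum_index_ge_of_geometric_growth:
  fixes c :: "nat \<Rightarrow> real"
  assumes "0 < q" "q < 1" "l \<le> n" "\<And>j. j \<le> n \<Longrightarrow> 0 \<le> c j"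
    and growth: "\<And>j. j < l \<Longrightarrow> c j \<le> q * c (Suc j)"
  shows "(real l - 1 / (1 - q)\<^sup>2) * (\<Sum>j\<le>n. c j) \<le> (\<Sum>j\<le>n. real j * c j)"
proof -
  have rev: "(\<Sum>j\<le>n. g (n - j)) = (\<Sum>j\<le>n. g j)" for g :: "nat \<Rightarrow> real"
    by (rule sum.reindex_bij_witness[of _ "\<lambda>j. n - j" "\<lambda>j. n - j"]) auto
  have "(\<Sum>j\<le>n. real j * c (n - j)) \<le> (real (n - l) + 1 / (1 - q)\<^sup>2) * (\<Sum>j\<le>n. c (n - j))"
  proof (rule sum_index_le_of_geometric_decay)
    fix j assume "n - l \<le> j" "j < n"
    then show "c (n - Suc j) \<le> q * c (n - j)"
      using growth[of "n - Suc j"] assms(3) by (simp add: Suc_diff_Suc)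
  qed (use assms in auto)
  also have "(\<Sum>j\<le>n. c (n - j)) = (\<Sum>j\<le>n. c j)" by (rule rev)
  also have "(\<Sum>j\<le>n. real j * c (n - j)) = (\<Sum>j\<le>n. real (n - j) * c j)"
    unfolding rev[of "\<lambda>j. real (n - j) * c j", symmetric] by (intro sum.cong) auto
  also have "\<dots> = (\<Sum>j\<le>n. real n * c j - real j * c j)"
    by (intro sum.cong) (auto simp: of_nat_diff algebra_simps)
  finally show ?thesis
    using assms(3) by (simp add: algebra_simps sum_subtractf sum_distrib_left of_nat_diff)
qed

text \<open>
  By log-concavity a bound on one coefficient ratio persists for all later (or all earlier) ratios,
  and passing from \<open>w\<close> to \<open>z\<close> turns monotonicity of the weights into geometric decay.
\<close>

lemma prod_linear_mean_le:
  fixes x :: "'a \<Rightarrow> real"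
  assumes A: "finite A" "\<And>j. j \<in> A \<Longrightarrow> 0 < x j" and l: "l < card A" and zw: "0 < z" "z < w"
    and ratio: "coeff (\<Prod>j\<in>A. [:1, x j:]) (Suc l) * w \<le> coeff (\<Prod>j\<in>A. [:1, x j:]) l"
  shows "(\<Sum>j\<in>A. x j * z / (1 + x j * z)) \<le> real l + 1 / (1 - z / w)\<^sup>2"
proof -
  define c where "c = coeff (\<Prod>j\<in>A. [:1, x j:])"
  have nonneg: "0 \<le> c j" for j
    unfolding c_def using A by (intro prod_linear_coeff_nonneg less_imp_le)
  have lpos: "0 < c l"
    unfolding c_def using A l by (intro prod_linear_pos_coeff_pos) auto
  have "(\<Sum>j\<le>card A. real j * (c j * z ^ j))
      \<le> (real l + 1 / (1 - z / w)\<^sup>2) * (\<Sum>j\<le>card A. c j * z ^ j)"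
  proof (rule sum_index_le_of_geometric_decay)
    fix j assume "l \<le> j" "j < card A"
    have "(c (Suc j) * w) * c l \<le> (c j * c (Suc l)) * w"
      using prod_linear_coeff_log_concave[of A x l j] A \<open>l \<le> j\<close> zw
      by (simp add: c_def less_imp_le mult_ac)
    also have "\<dots> \<le> c j * c l"
      using ratio nonneg[of j] by (simp add: mult.assoc mult_left_mono flip: c_def)
    finally have "c (Suc j) * w \<le> c j" using lpos by simp
    then have "(c (Suc j) * w) * (z / w * z ^ j) \<le> c j * (z / w * z ^ j)"
      using zw by (intro mult_right_mono) auto
    then show "c (Suc j) * z ^ Suc j \<le> z / w * (c j * z ^ j)"
      using zw by (simp add: mult_ac)
  qed (use zw l nonneg in auto)
  moreover have "(\<Sum>j\<le>card A. c j * z ^ j) = (\<Prod>j\<in>A. 1 + x j * z)"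
    unfolding c_def by (rule sum_coeff_prod_linear[OF A(1)])
  moreover have "(\<Sum>j\<le>card A. real j * (c j * z ^ j))
      = (\<Prod>j\<in>A. 1 + x j * z) * (\<Sum>j\<in>A. x j * z / (1 + x j * z))"
    unfolding c_def using A zw by (intro sum_index_coeff_prod_linear) (auto intro: less_imp_le)
  moreover have "0 < (\<Prod>j\<in>A. 1 + x j * z)"
    using A zw by (intro prod_pos add_pos_nonneg mult_nonneg_nonneg) (auto intro: less_imp_le)
  ultimately show ?thesis by (simp add: mult.commute)
qed

lemma prod_linear_mean_ge:
  fixes x :: "'a \<Rightarrow> real"
  assumes A: "finite A" "\<And>j. j \<in> A \<Longrightarrow> 0 < x j" and l: "l < card A" and zw: "0 < w" "w < z"
    and ratio: "coeff (\<Prod>j\<in>A. [:1, x j:]) l \<le> coeff (\<Prod>j\<in>A. [:1, x j:]) (Suc l) * w"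
  shows "real (Suc l) - 1 / (1 - w / z)\<^sup>2 \<le> (\<Sum>j\<in>A. x j * z / (1 + x j * z))"
proof -
  define c where "c = coeff (\<Prod>j\<in>A. [:1, x j:])"
  have nonneg: "0 \<le> c j" for j
    unfolding c_def using A by (intro prod_linear_coeff_nonneg less_imp_le)
  have lpos: "0 < c (Suc l)"
    unfolding c_def using A l by (intro prod_linear_pos_coeff_pos) auto
  have "(real (Suc l) - 1 / (1 - w / z)\<^sup>2) * (\<Sum>j\<le>card A. c j * z ^ j)
      \<le> (\<Sum>j\<le>card A. real j * (c j * z ^ j))"
  proof (rule sum_index_ge_of_geometric_growth)
    \<comment> \<open>The assumed ratio is itself the last growth step, \<open>j = l\<close>, so the
      growth reaches \<open>Suc l\<close>, whereas the decay in \<open>prod_linear_mean_le\<close>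
      starts at \<open>l\<close>.\<close>
    fix j assume "j < Suc l"
    have "c j * c (Suc l) \<le> c l * c (Suc j)"
      using prod_linear_coeff_log_concave[of A x j l] A \<open>j < Suc l\<close>
      by (simp add: c_def less_imp_le mult_ac)
    also have "\<dots> \<le> (c (Suc l) * w) * c (Suc j)"
      using ratio nonneg[of "Suc j"] by (simp add: mult_right_mono flip: c_def)
    finally have "c j \<le> w * c (Suc j)" using lpos by (simp add: mult_ac)
    then have "c j * z ^ j \<le> (w * c (Suc j)) * z ^ j"
      using zw by (intro mult_right_mono) auto
    then show "c j * z ^ j \<le> w / z * (c (Suc j) * z ^ Suc j)"
      using zw by (simp add: mult_ac)
  qed (use zw l nonneg in auto)
  moreover have "(\<Sum>j\<le>card A. c j * z ^ j) = (\<Prod>j\<in>A. 1 + x j * z)"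
    unfolding c_def by (rule sum_coeff_prod_linear[OF A(1)])
  moreover have "(\<Sum>j\<le>card A. real j * (c j * z ^ j))
      = (\<Prod>j\<in>A. 1 + x j * z) * (\<Sum>j\<in>A. x j * z / (1 + x j * z))"
    unfolding c_def using A zw by (intro sum_index_coeff_prod_linear) (auto intro: less_imp_le)
  moreover have "0 < (\<Prod>j\<in>A. 1 + x j * z)"
    using A zw by (intro prod_pos add_pos_nonneg mult_nonneg_nonneg) (auto intro: less_imp_le)
  ultimately show ?thesis by (simp add: mult.commute)
qed

section \<open>The limiting mean and the moment series\<close>

lemma saturation_bounds:
  assumes "0 \<le> z"
  shows "0 \<le> max 0 y * z / (1 + max 0 y * z)" "max 0 y * z / (1 + max 0 y * z) < (1::real)"
    "norm (max 0 y * z / (1 + max 0 y * z)) \<le> 1"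
proof -
  have "0 \<le> max 0 y * z" using assms by simp
  then show "0 \<le> max 0 y * z / (1 + max 0 y * z)" "max 0 y * z / (1 + max 0 y * z) < 1"
    "norm (max 0 y * z / (1 + max 0 y * z)) \<le> 1"
    by (auto simp: divide_simps)
qed

text \<open>
  On \<open>[0, \<infinity>)\<close> the integrand is \<open>yz / (1 + yz)\<close>, so the integral is \<open>-M(-z)\<close>.  The truncation
  \<open>max 0 y\<close> makes the integrand bounded and continuous on the whole line, as weak convergence requires.
\<close>

definition saturation_mean :: "real measure \<Rightarrow> real \<Rightarrow> real" where
  "saturation_mean \<mu> z = (LINT y|\<mu>. max 0 y * z / (1 + max 0 y * z))"

lemma integrable_saturation:
  assumes "real_distribution \<mu>" "0 \<le> z"
  shows "integrable \<mu> (\<lambda>y. max 0 y * z / (1 + max 0 y * z))"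
proof -
  interpret real_distribution \<mu> by fact
  show ?thesis
    using saturation_bounds[OF assms(2)]
    by (intro integrable_const_bound[where B = 1] AE_I2) auto
qed

text \<open>The integrand is strictly increasing in \<open>z\<close> at every \<open>y > 0\<close>,
  hence almost everywhere, and the total mass is positive.\<close>

lemma saturation_mean_strict_mono:
  assumes "real_distribution \<mu>" "AE y in \<mu>. 0 < y" "0 \<le> z" "z < w"
  shows "saturation_mean \<mu> z < saturation_mean \<mu> w"
proof -
  interpret real_distribution \<mu> by fact
  show ?thesis
    unfolding saturation_mean_def
  proof (rule integral_less_AE_space)
    have "max 0 y * z / (1 + max 0 y * z) < max 0 y * w / (1 + max 0 y * w)" if "0 < y" for y
    proof -
      have "0 \<le> y * z" "y * z < y * w" using assms that by auto
      moreover from this have "1 + y * z > 0" "1 + y * w > 0" by auto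
      ultimately show ?thesis using that 
        by (simp add: max_def frac_less_eq divide_less_eq less_divide_eq mult.commute[of "1 + _"] algebra_simps)
    qed
    with assms(2) show "AE y in \<mu>. max 0 y * z / (1 + max 0 y * z) < max 0 y * w / (1 + max 0 y * w)"
      by (rule eventually_mono)
  qed (use assms emeasure_space_1 in \<open>auto intro!: integrable_saturation\<close>)
qed

text \<open>Together with strict growth from \<open>0\<close>, this places the values at
  \<open>z > 0\<close> in the open unit interval, where the ratio limit is unique.\<close>

lemma saturation_mean_less_1:
  assumes "real_distribution \<mu>" "0 \<le> z"
  shows "saturation_mean \<mu> z < 1"
proof -
  interpret real_distribution \<mu> by fact
  have "saturation_mean \<mu> z < (LINT y|\<mu>. 1)"
    unfolding saturation_mean_def
    using assms saturation_bounds[OF assms(2)] emeasure_space_1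
    by (intro integral_less_AE_space integrable_saturation) auto
  then show ?thesis using prob_space by simp
qed

lemma saturation_mean_0 [simp]: "saturation_mean \<mu> 0 = 0"
  by (simp add: saturation_mean_def)

lemma real_distribution_zero_counting_measure:
  assumes "1 \<le> n"
  shows "real_distribution (zero_counting_measure n x)"
proof -
  interpret prob_space "uniform_count_measure {1..n}"
    using assms by (intro prob_space_uniform_count_measure) auto
  show ?thesis
    unfolding zero_counting_measure_def
    by (intro real_distribution_distr) (simp add: measurable_def sets_uniform_count_measure
      space_uniform_count_measure)
qed

lemma integral_zero_counting_measure:
  fixes g :: "real \<Rightarrow> real"
  assumes "g \<in> borel_measurable borel"
  shows "integral\<^sup>L (zero_counting_measure n x) g = (\<Sum>j=1..n. g (x j)) / real n"
  unfolding zero_counting_measure_def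
  by (subst integral_distr)
     (use assms in \<open>auto simp: integral_uniform_count_measure measurable_def
       sets_uniform_count_measure space_uniform_count_measure\<close>)

text \<open>The normalised sum is the integral of a bounded continuous function against the zero
  counting measure, the truncation having no effect at positive zeros.\<close>

lemma zero_mean_tendsto_saturation_mean:
  fixes x :: "nat \<Rightarrow> nat \<Rightarrow> real"
  assumes pos: "\<And>n j. 1 \<le> j \<Longrightarrow> j \<le> n \<Longrightarrow> 0 < x n j"
    and \<mu>: "real_distribution \<mu>"
    and conv: "weak_conv_m (\<lambda>n. zero_counting_measure n (x n)) \<mu>"
    and z: "0 \<le> z"
  shows "(\<lambda>n. (\<Sum>j=1..n. x n j * z / (1 + x n j * z)) / real n) \<longlonglongrightarrow> saturation_mean \<mu> z"
proof -
  let ?g = "\<lambda>y. max 0 y * z / (1 + max 0 y * z)"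
  have "1 + max 0 y * z \<noteq> 0" for y
    using z by (smt (verit) mult_nonneg_nonneg)
  then have cont: "isCont ?g y" for y
    by (intro continuous_intros) auto
  then have [measurable]: "?g \<in> borel_measurable borel"
    by (intro borel_measurable_continuous_onI continuous_at_imp_continuous_on) auto
  \<comment> \<open>The shift skips \<open>n = 0\<close>, where there are no zeros to carry a
    probability measure.\<close>
  have "weak_conv_m (\<lambda>n. zero_counting_measure (Suc n) (x (Suc n))) \<mu>"
    using conv unfolding weak_conv_m_def weak_conv_def
    by (auto intro: LIMSEQ_Suc)
  then have "(\<lambda>n. integral\<^sup>L (zero_counting_measure (Suc n) (x (Suc n))) ?g)
      \<longlonglongrightarrow> saturation_mean \<mu> z"
    unfolding saturation_mean_def
    by (intro weak_conv_imp_integral_bdd_continuous_conv[where B = 1] \<mu> cont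
        saturation_bounds(3)[OF z] real_distribution_zero_counting_measure) auto
  then have lim: "(\<lambda>n. integral\<^sup>L (zero_counting_measure n (x n)) ?g) \<longlonglongrightarrow> saturation_mean \<mu> z"
    by (rule LIMSEQ_imp_Suc)
  have "integral\<^sup>L (zero_counting_measure n (x n)) ?g
      = (\<Sum>j=1..n. x n j * z / (1 + x n j * z)) / real n" for n
    unfolding integral_zero_counting_measure[OF \<open>?g \<in> borel_measurable borel\<close>]
    using pos[of _ n] by (intro arg_cong2[where f = "(/)"] sum.cong) (auto simp: max_absorb2 less_imp_le)
  then show ?thesis using lim by simp
qed

text \<open>Only finite geometric sums are integrated, so no interchange of limit and integral
  occurs. The error of a partial sum is at most the modulus of the next term of the series, which
  tends to \<open>0\<close> inside the disc of convergence.\<close>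

lemma moment_function_neg:
  assumes \<mu>: "real_distribution \<mu>" and nonneg: "AE y in \<mu>. 0 \<le> y"
    and moments: "\<And>m. integrable \<mu> (\<lambda>y. y ^ m)"
    and z: "0 \<le> z" "ereal z < fps_conv_radius (moment_series \<mu>)"
  shows "moment_function \<mu> (of_real (- z)) = of_real (- saturation_mean \<mu> z)"
proof -
  interpret real_distribution \<mu> by fact
  define s where "s N = (\<Sum>m<N. fps_nth (moment_series \<mu>) m * of_real (- z) ^ m)" for N
  define mom where "mom m = (LINT y|\<mu>. y ^ m)" for m
  have s_lim: "s \<longlonglongrightarrow> moment_function \<mu> (of_real (- z))"
    using sums_eval_fps[of "of_real (- z) :: complex" "moment_series \<mu>"] z
    unfolding s_def moment_function_def sums_def by simp
  have bound: "norm (s (Suc N) - of_real (- saturation_mean \<mu> z))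
      \<le> norm (fps_nth (moment_series \<mu>) (Suc N) * of_real (- z) ^ Suc N)" for N
  proof -
    have "s (Suc N) = (\<Sum>m<N. of_real (mom (Suc m) * (- z) ^ Suc m))"
      unfolding s_def by (subst sum.lessThan_Suc_shift) (simp add: moment_series_def mom_def)
    then have s_eq: "s (Suc N) = of_real (\<Sum>m<N. mom (Suc m) * (- z) ^ Suc m)" by simp
    have "(\<Sum>m<N. mom (Suc m) * (- z) ^ Suc m) = (LINT y|\<mu>. (\<Sum>m<N. (- (y * z)) ^ Suc m))"
    proof (subst Bochner_Integration.integral_sum)
      have eq: "(- (y * z)) ^ Suc m = y ^ Suc m * (- z) ^ Suc m" for y m
        by (simp flip: power_mult_distrib add: mult_ac)
      show "integrable \<mu> (\<lambda>y. (- (y * z)) ^ Suc m)" for m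
        unfolding eq by (intro integrable_mult_left moments)
      show "(\<Sum>m<N. mom (Suc m) * (- z) ^ Suc m) = (\<Sum>m<N. LINT y|\<mu>. (- (y * z)) ^ Suc m)"
        unfolding eq mom_def by simp
    qed
    then have "(\<Sum>m<N. mom (Suc m) * (- z) ^ Suc m) + saturation_mean \<mu> z
      = (LINT y|\<mu>. (\<Sum>m<N. (- (y * z)) ^ Suc m) + max 0 y * z / (1 + max 0 y * z))"
      unfolding saturation_mean_def using integrable_saturation[OF \<mu> z(1)]
    proof (subst Bochner_Integration.integral_add)
      have eq: "(- (y * z)) ^ Suc m = y ^ Suc m * (- z) ^ Suc m" for y m
        by (simp flip: power_mult_distrib add: mult_ac)
      show "integrable \<mu> (\<lambda>y. \<Sum>m<N. (- (y * z)) ^ Suc m)"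
        unfolding eq by (intro Bochner_Integration.integrable_sum integrable_mult_left moments)
    qed auto
    also have "\<bar>\<dots>\<bar> \<le> (LINT y|\<mu>. y ^ Suc N * z ^ Suc N)"
    proof (rule order_trans[OF integral_abs_bound], rule integral_mono_AE')
      show "integrable \<mu> (\<lambda>y. y ^ Suc N * z ^ Suc N)"
        by (intro integrable_mult_left moments)
      have "\<bar>(\<Sum>m<N. (- (y * z)) ^ Suc m) + max 0 y * z / (1 + max 0 y * z)\<bar> \<le> y ^ Suc N * z ^ Suc N"
        if "0 \<le> y" for y
      proof -
        define v where "v = y * z"
        have v: "0 \<le> v" using that z by (simp add: v_def)
        \<comment> \<open>The geometric sum telescopes; adding \<open>v / (1 + v)\<close> leaves
          only the remainder, of modulus \<open>v ^ Suc N / (1 + v)\<close>.\<close>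
        have "(\<Sum>m<N. (- v) ^ Suc m) * (1 + v) = - v - (- v) ^ Suc N"
          by (induction N) (auto simp: algebra_simps)
        then have "(\<Sum>m<N. (- v) ^ Suc m) + v / (1 + v) = - ((- v) ^ Suc N) / (1 + v)"
          using v by (simp add: field_simps)
        also have "\<bar>\<dots>\<bar> = v ^ Suc N / (1 + v)"
          using v by (simp add: abs_divide power_abs del: power_Suc)
        also have "\<dots> \<le> v ^ Suc N / 1"
          using v by (intro divide_left_mono) auto
        finally show ?thesis using that by (simp add: v_def power_mult_distrib del: power_Suc)
      qed
      with nonneg show "AE y in \<mu>. \<bar>(\<Sum>m<N. (- (y * z)) ^ Suc m) + max 0 y * z / (1 + max 0 y * z)\<bar>
          \<le> y ^ Suc N * z ^ Suc N"
        by (rule eventually_mono)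
      show "AE y in \<mu>. 0 \<le> y ^ Suc N * z ^ Suc N"
        using nonneg by (rule eventually_mono) (use z in auto)
    qed
    also have "\<dots> = mom (Suc N) * z ^ Suc N" by (simp add: mom_def)
    also have "\<dots> \<le> norm (fps_nth (moment_series \<mu>) (Suc N) * of_real (- z) ^ Suc N)"
      using z(1) by (simp add: moment_series_def mom_def norm_mult norm_power mult_right_mono)
    finally show ?thesis
      unfolding s_eq by (simp only: of_real_minus diff_minus_eq_add flip: of_real_add norm_of_real)
        (simp only: norm_of_real)
  qed
  have bound_lim: "(\<lambda>N. norm (fps_nth (moment_series \<mu>) (Suc N) * of_real (- z) ^ Suc N)) \<longlonglongrightarrow> 0"
    using summable_LIMSEQ_zero[OF summable_fps[of "of_real (- z) :: complex" "moment_series \<mu>"]] z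
    by (intro tendsto_norm_zero LIMSEQ_Suc) simp
  have "(\<lambda>N. s (Suc N) - of_real (- saturation_mean \<mu> z)) \<longlonglongrightarrow> 0"
    by (rule Lim_null_comparison[OF always_eventually[OF allI[OF bound]] bound_lim])
  then have "(\<lambda>N. s (Suc N)) \<longlonglongrightarrow> of_real (- saturation_mean \<mu> z)"
    by (rule LIM_zero_cancel)
  then show ?thesis
    using LIMSEQ_unique[OF LIMSEQ_Suc[OF s_lim]] by simp
qed

section \<open>Ratio limits and the inverse of the moment series\<close>

text \<open>Both halves argue by contradiction: a ratio on the wrong side of \<open>l\<close> or
  \<open>u\<close> bounds the mean at a nearby point \<open>v\<close> by \<open>k n\<close> up to a
  constant. After division by \<open>n\<close> this contradicts the strict inequality between the
  limiting means at \<open>z\<close> and \<open>v\<close>.\<close>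

lemma has_ratio_limit_saturation_mean:
  fixes x a :: "nat \<Rightarrow> nat \<Rightarrow> real"
  assumes pos: "\<And>n j. 1 \<le> j \<Longrightarrow> j \<le> n \<Longrightarrow> 0 < x n j"
    and coeffs: "\<And>n k. 1 \<le> n \<Longrightarrow> k \<le> n \<Longrightarrow> a n k = coeff (\<Prod>j=1..n. [:1, x n j:]) k"
    and \<mu>: "real_distribution \<mu>" "AE y in \<mu>. 0 < y"
    and conv: "weak_conv_m (\<lambda>n. zero_counting_measure n (x n)) \<mu>"
    and z: "0 < z"
  shows "has_ratio_limit a (saturation_mean \<mu> z) (1 / z)"
  unfolding has_ratio_limit_def
proof (intro allI impI)
  fix k :: "nat \<Rightarrow> nat"
  assume k: "\<forall>n\<ge>1. 1 \<le> k n \<and> k n \<le> n"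
    and k_lim: "(\<lambda>n. real (k n) / real n) \<longlonglongrightarrow> saturation_mean \<mu> z"
  define mean where "mean n v = (\<Sum>j=1..n. x n j * v / (1 + x n j * v))" for n v
  have mean_lim: "(\<lambda>n. mean n v / real n) \<longlonglongrightarrow> saturation_mean \<mu> v" if "0 \<le> v" for v
    unfolding mean_def by (rule zero_mean_tendsto_saturation_mean[OF pos \<mu>(1) conv that])
  have k_lim': "(\<lambda>n. (real (k n) + C) / real n) \<longlonglongrightarrow> saturation_mean \<mu> z" for C
    using tendsto_add[OF k_lim tendsto_divide_0[OF tendsto_const filterlim_real_at_infinity_sequentially]]
    by (simp add: add_divide_distrib)
  have a_pos: "0 < a n i" if "1 \<le> n" "i \<le> n" for n i
    unfolding coeffs[OF that] using pos that by (intro prod_linear_pos_coeff_pos) auto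
  show "(\<lambda>n. a n (k n) / a n (k n - 1)) \<longlonglongrightarrow> 1 / z"
  proof (rule order_tendstoI)
    fix l assume l: "l < 1 / z"
    show "\<forall>\<^sub>F n in sequentially. l < a n (k n) / a n (k n - 1)"
    proof (cases "0 < l")
      \<comment> \<open>For \<open>l \<le> 0\<close> positivity of the coefficients suffices; the
        other case needs the reciprocal \<open>1 / l\<close>.\<close>
      case False
      show ?thesis
        using eventually_ge_at_top[of 1]
      proof eventually_elim
        case (elim n)
        have "k n \<le> n" using elim k by auto
        then have "0 < a n (k n)" "0 < a n (k n - 1)"
          using elim by (auto intro: a_pos)
        then have "0 < a n (k n) / a n (k n - 1)" by simp
        then show ?case using False by linarith
      qed
    next
      case True
      then have "z < 1 / l" using l z by (simp add: field_simps)
      \<comment> \<open>The gap to \<open>1 / l\<close> gives the decay factor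
        \<open>v * l < 1\<close>, and the gap to \<open>z\<close> gives a strictly larger limiting
        mean. Neither \<open>v\<close> nor \<open>C\<close> depends on \<open>n\<close>.\<close>
      then obtain v where v: "z < v" "v < 1 / l" using dense by blast
      define C where "C = 1 / (1 - v / (1 / l))\<^sup>2"
      have "saturation_mean \<mu> z < saturation_mean \<mu> v"
        using saturation_mean_strict_mono[OF \<mu>] v z by simp
      then obtain b where b: "saturation_mean \<mu> z < b" "b < saturation_mean \<mu> v"
        using dense by blast
      have "\<forall>\<^sub>F n in sequentially. (real (k n) + C) / real n < b"
        using order_tendstoD(2)[OF k_lim' b(1)] .
      moreover have "\<forall>\<^sub>F n in sequentially. b < mean n v / real n"
        using order_tendstoD(1)[OF mean_lim b(2)] v z by simp
      ultimately show ?thesis using eventually_ge_at_top[of 1]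
      proof eventually_elim
        case (elim n)
        have n: "1 \<le> n" "1 \<le> k n" "k n \<le> n" using elim k by auto
        show ?case
        proof (rule ccontr)
          assume "\<not> ?thesis"
          moreover have "0 < a n (k n - 1)" using n by (intro a_pos) auto
          ultimately have "a n (k n) * (1 / l) \<le> a n (k n - 1)"
            using True by (simp add: field_simps)
          \<comment> \<open>The mean bound is used with \<open>w = 1 / l\<close> and index
            \<open>k n - 1\<close>, whose successor is \<open>k n\<close> because
            \<open>1 \<le> k n\<close>.\<close>
          then have "mean n v \<le> real (k n - 1) + C"
            unfolding mean_def C_def using n v z pos
            by (intro prod_linear_mean_le) (auto simp: coeffs)
          then have "mean n v / real n \<le> (real (k n) + C) / real n"
            by (intro divide_right_mono) auto
          then show False using elim by linarith
        qed
      qed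
    qed
  next
    fix u assume u: "1 / z < u"
    then have u0: "0 < u" using z by (meson less_trans zero_less_divide_1_iff)
    then have "1 / u < z" using u z by (simp add: field_simps)
    then obtain v where v: "1 / u < v" "v < z" using dense by blast
    have v0: "0 < v" using u0 v by (meson less_trans zero_less_divide_1_iff)
    define C where "C = 1 / (1 - (1 / u) / v)\<^sup>2"
    have "saturation_mean \<mu> v < saturation_mean \<mu> z"
      using saturation_mean_strict_mono[OF \<mu>] v v0 by simp
    then obtain b where b: "saturation_mean \<mu> v < b" "b < saturation_mean \<mu> z"
      using dense by blast
    have "\<forall>\<^sub>F n in sequentially. b < (real (k n) + - C) / real n"
      using order_tendstoD(1)[OF k_lim' b(2)] .
    moreover have "\<forall>\<^sub>F n in sequentially. mean n v / real n < b"
      using order_tendstoD(2)[OF mean_lim b(1)] v0 by simp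
    ultimately show "\<forall>\<^sub>F n in sequentially. a n (k n) / a n (k n - 1) < u"
      using eventually_ge_at_top[of 1]
    proof eventually_elim
      case (elim n)
      have n: "1 \<le> n" "1 \<le> k n" "k n \<le> n" using elim k by auto
      show ?case
      proof (rule ccontr)
        assume "\<not> ?thesis"
        moreover have "0 < a n (k n - 1)" using n by (intro a_pos) auto
        ultimately have "a n (k n - 1) \<le> a n (k n) * (1 / u)"
          using u0 by (simp add: field_simps)
        then have "real (Suc (k n - 1)) - C \<le> mean n v"
          unfolding mean_def C_def using n v u0 pos
          by (intro prod_linear_mean_ge) (auto simp: coeffs)
        then have "(real (k n) + - C) / real n \<le> mean n v / real n"
          using n by (intro divide_right_mono) auto
        then show False using elim by linarith
      qed
    qed
  qed
qed

text \<open>The derivative at \<open>0\<close> is the first moment, which is positive because almost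
  every \<open>y\<close> is. Hence a local inverse exists and the choice in
  \<open>moment_inverse\<close> is legitimate.\<close>

lemma local_inverse_at_0_moment_inverse:
  assumes "real_distribution \<mu>" "AE y in \<mu>. 0 < y" "integrable \<mu> (\<lambda>y. y)"
    and radius: "fps_conv_radius (moment_series \<mu>) > 0"
  shows "local_inverse_at_0 (moment_function \<mu>) (moment_inverse \<mu>)"
proof -
  interpret real_distribution \<mu> by fact
  have "(LINT y|\<mu>. 0) < (LINT y|\<mu>. y)"
    using assms emeasure_space_1 by (intro integral_less_AE_space) auto
  moreover have "deriv (moment_function \<mu>) 0 = fps_nth (moment_series \<mu>) 1"
    unfolding moment_function_def using radius fps_nth_conv_deriv[OF radius, of 1] by simp
  ultimately have "deriv (moment_function \<mu>) 0 \<noteq> 0"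
    by (simp add: moment_series_def)
  moreover have "moment_function \<mu> analytic_on {0}"
    unfolding moment_function_def using radius
    by (intro analytic_on_eval_fps) (auto simp: eball_def zero_ereal_def)
  moreover have "moment_function \<mu> 0 = 0"
    by (simp add: moment_function_def eval_fps_at_0 moment_series_def)
  ultimately show ?thesis
    unfolding moment_inverse_def by (intro someI_ex[OF local_inverse_at_0_exists])
qed

text \<open>By the intermediate value theorem every small negative \<open>u\<close> is a value of
  the moment function at some small \<open>- z\<close>, and there the local inverse recovers
  \<open>- z\<close>.\<close>

lemma eventually_moment_inverse_saturation_mean:
  assumes \<mu>: "real_distribution \<mu>" "AE y in \<mu>. 0 < y"
    and moments: "\<And>m. integrable \<mu> (\<lambda>y. y ^ m)"
    and radius: "fps_conv_radius (moment_series \<mu>) > 0"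
  shows "\<forall>\<^sub>F u in at_left (0::real). \<exists>z>0. u = - saturation_mean \<mu> z \<and>
           moment_inverse \<mu> (of_real u) = of_real (- z)"
proof -
  have nonneg: "AE y in \<mu>. 0 \<le> y" using \<mu>(2) by (rule eventually_mono) simp
  have "\<forall>\<^sub>F w in nhds 0. moment_inverse \<mu> (moment_function \<mu> w) = w"
    using local_inverse_at_0_moment_inverse[OF \<mu> _ radius] moments[of 1]
    by (simp add: local_inverse_at_0_def)
  then obtain e where e: "0 < e" "\<And>w. norm w < e \<Longrightarrow> moment_inverse \<mu> (moment_function \<mu> w) = w"
    unfolding eventually_nhds_metric by auto
  obtain R where R: "0 < R" "ereal R < fps_conv_radius (moment_series \<mu>)"
    using ereal_dense2[OF radius] by (auto simp: zero_ereal_def)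
  \<comment> \<open>Halving \<open>e\<close> keeps all of \<open>{0..d}\<close> strictly inside the
    neighbourhood where the inverse works, and \<open>R\<close> keeps it inside the disc of
    convergence.\<close>
  define d where "d = min (e / 2) R"
  have d: "0 < d" "d < e" "d \<le> R" using e R by (auto simp: d_def)
  have M: "moment_function \<mu> (of_real (- z)) = of_real (- saturation_mean \<mu> z)"
    if "0 \<le> z" "z \<le> d" for z
    using that d by (intro moment_function_neg \<mu> nonneg moments order_le_less_trans[OF _ R(2)]) auto
  \<comment> \<open>Continuity of the limiting mean is read off from the power series that
    represents it on this interval.\<close>
  have "continuous_on {0..d} (\<lambda>z. - Re (eval_fps (moment_series \<mu>) (of_real (- z))))"
    using d order_le_less_trans[OF _ R(2)]
    by (intro continuous_intros continuous_on_compose2[OF continuous_on_eval_fps])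
       (auto simp: eball_def)
  also have "?this \<longleftrightarrow> continuous_on {0..d} (saturation_mean \<mu>)"
    using M by (intro continuous_on_cong) (auto simp: moment_function_def)
  finally have cont: "continuous_on {0..d} (saturation_mean \<mu>)" .
  have "0 < saturation_mean \<mu> d"
    using saturation_mean_strict_mono[OF \<mu>, of 0 d] d by simp
  then have "\<forall>\<^sub>F u in at_left 0. u \<in> {- saturation_mean \<mu> d<..<0}"
    by (intro eventually_at_left_real) simp
  then show ?thesis
  proof eventually_elim
    case (elim u)
    then obtain z where z: "0 \<le> z" "z \<le> d" "saturation_mean \<mu> z = - u"
      using IVT'[of "saturation_mean \<mu>" 0 "- u" d] cont d by auto
    then have "z \<noteq> 0" using elim by auto
    moreover have "moment_inverse \<mu> (of_real (- saturation_mean \<mu> z)) = of_real (- z)"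
      using M[OF z(1,2)] e(2)[of "of_real (- z)"] z d by simp
    ultimately show ?case using z by (intro exI[of _ z]) auto
  qed
qed

theorem corollary1:
  fixes p :: "nat \<Rightarrow> real poly"
    and x a :: "nat \<Rightarrow> nat \<Rightarrow> real"
    and \<mu> :: "real measure"
    and f :: "real \<Rightarrow> real"
  assumes zeros_pos: "\<And>n j. 1 \<le> j \<Longrightarrow> j \<le> n \<Longrightarrow> 0 < x n j"
    and p_zeros: "\<And>n. 1 \<le> n \<Longrightarrow> p n = (\<Prod>j=1..n. [:- x n j, 1:])"
    and p_coeffs: "\<And>n. 1 \<le> n \<Longrightarrow> p n = (\<Sum>k=0..n. monom ((-1) ^ k * a n k) (n - k))"
    and mu_distribution: "real_distribution \<mu>"
    and mu_nonneg: "measure \<mu> {0..} = 1"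
    and mu_zero: "measure \<mu> {0} = 0"
    and weak_limit: "weak_conv_m (\<lambda>n. zero_counting_measure n (x n)) \<mu>"
    and moments_finite: "\<And>m. integrable \<mu> (\<lambda>y. y ^ m)"
    and moment_radius: "fps_conv_radius (moment_series \<mu>) > 0"
    and f_def: "\<And>t. 0 < t \<Longrightarrow> t < 1 \<Longrightarrow> f t = ratio_limit a t"
  shows "\<forall>\<^sub>F u in at_left (0::real).
           S_transform \<mu> (of_real u) = of_real (- ((u + 1) / u) * (1 / f (- u)))"
proof -
  interpret real_distribution \<mu> by (fact mu_distribution)
  have "AE y in \<mu>. y \<in> {0..}"
    using mu_nonneg by (subst prob_eq_1[symmetric]) auto
  moreover have "AE y in \<mu>. y \<notin> {0}"
    using mu_zero by (subst AE_iff_measurable[of "{0}"]) (auto simp: emeasure_eq_measure)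
  ultimately have AE_pos: "AE y in \<mu>. 0 < y"
    by eventually_elim auto
  have coeffs: "a n k = coeff (\<Prod>j=1..n. [:1, x n j:]) k" if "1 \<le> n" "k \<le> n" for n k
    using p_zeros[OF that(1)] p_coeffs[OF that(1)] that(2)
    by (intro coeff_prod_linear_reverse[symmetric]) (auto simp: atMost_atLeast0)
  show ?thesis
    using eventually_moment_inverse_saturation_mean[OF mu_distribution AE_pos moments_finite moment_radius]
  proof eventually_elim
    case (elim u)
    then obtain z where z: "0 < z" "u = - saturation_mean \<mu> z"
        "moment_inverse \<mu> (of_real u) = of_real (- z)" by blast
    \<comment> \<open>These bounds allow \<open>f (- u)\<close> to be identified with the ratio
      limit.\<close>
    have u: "0 < - u" "- u < 1"
      using saturation_mean_strict_mono[OF mu_distribution AE_pos, of 0 z]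
        saturation_mean_less_1[OF mu_distribution, of z] z by auto
    have "has_ratio_limit a (- u) (1 / z)"
      using has_ratio_limit_saturation_mean[OF zeros_pos coeffs mu_distribution AE_pos weak_limit z(1)]
        z(2) by simp
    then have "f (- u) = 1 / z"
      using f_def ratio_limit_eqI u by auto
    then show ?case using u z(3) by (simp add: S_transform_def)
  qed
qed

end
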